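(* Let $n\ge2$, let $K$ be a convex body in $\mathbb{R}^n$ and let $O\in\partial K$. The function $e_K:\mathbb{R}^n\to\mathbb{R}$ is continuous at $O$ if and only if there exists a chord $S$ of maximal length (that is, a chord of $K$ cut by a line through $O$, of length $e_K(O)$) such that $O$ is an endpoint of $S$; equivalently, if and only if there exists $O'\in\partial K$ such that $e_K(O)=|OO'|$. In the case of continuity, $O'$ must be an extreme point of $K$.
   Context: A convex body in $\mathbb{R}^n$ is a compact convex set with nonempty interior. For $O\in\mathbb{R}^n$, $e_K(O)$ is the maximal length of a chord $L\cap K$ of $K$ cut by a line $L$ through $O$. A point $P\in K$ is extreme if, for any line segment $S\subset K$ with $P\in S$, $P$ is an endpoint of $S$. *)

theory Defs
  imports "HOL-Analysis.Analysis"
begin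

definition convex_body :: "'a::euclidean_space set \<Rightarrow> bool" where
  "convex_body K \<longleftrightarrow> compact K \<and> convex K \<and> interior K \<noteq> {}"

definition is_line :: "'a::euclidean_space set \<Rightarrow> bool" where
  "is_line L \<longleftrightarrow> affine L \<and> aff_dim L = 1"

text \<open>The segment with endpoints \<open>a\<close>, \<open>b\<close> is the chord cut from \<open>K\<close> by a line through \<open>p\<close>.
  The point \<open>p\<close> need not lie in \<open>K\<close>, and the chord may degenerate to one point (\<open>a = b\<close>).\<close>

definition chord_through :: "'a::euclidean_space set \<Rightarrow> 'a \<Rightarrow> 'a \<Rightarrow> 'a \<Rightarrow> bool" where
  "chord_through K p a b \<longleftrightarrow> (\<exists>L. is_line L \<and> p \<in> L \<and> L \<inter> K = closed_segment a b)"

text \<open>For a convex body the supremum is a maximum, see \<open>max_chord_length_attained\<close> below.\<close>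

definition max_chord_length :: "'a::euclidean_space set \<Rightarrow> 'a \<Rightarrow> real" where
  "max_chord_length K p = Sup {dist a b | a b. chord_through K p a b}"

lemma chord_through_exists:
  fixes K :: "'a::euclidean_space set"
  assumes K: "compact K" "convex K" and L: "is_line L" "p \<in> L" and ne: "L \<inter> K \<noteq> {}"
  shows "\<exists>a b. chord_through K p a b \<and> L \<inter> K = closed_segment a b"
proof -
  have aff: "affine L" and dim: "aff_dim L = 1" using L by (auto simp: is_line_def)
  have "compact (L \<inter> K)"
    using K aff by (simp add: affine_closed closed_Int_compact)
  moreover have "convex (L \<inter> K)" using K aff affine_imp_convex convex_Int by blast
  moreover have "collinear (L \<inter> K)"
    using dim aff_dim_subset[of "L \<inter> K" L] by (auto simp: collinear_aff_dim)
  ultimately obtain a b where "L \<inter> K = closed_segment a b"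
    using ne compact_convex_collinear_segment[of "L \<inter> K"] by metis
  then show ?thesis using L unfolding chord_through_def by blast
qed

lemma chord_through_collinear:
  assumes "chord_through K p a b"
  shows "collinear {p, a, b}" "a \<in> K" "b \<in> K"
proof -
  obtain L where L: "is_line L" "p \<in> L" "L \<inter> K = closed_segment a b"
    using assms unfolding chord_through_def by blast
  then have ab: "a \<in> L \<inter> K" "b \<in> L \<inter> K" by auto
  then show "a \<in> K" "b \<in> K" by auto
  have "{p, a, b} \<subseteq> L" using L ab by auto
  then show "collinear {p, a, b}"
    using L aff_dim_subset[of "{p, a, b}" L] by (auto simp: is_line_def collinear_aff_dim)
qed

lemma collinear3_closed:
  fixes p :: "'a::euclidean_space"
  shows "closed {z. collinear {p, fst z, snd z}}"
proof -
  have eq: "{z. collinear {p, fst z, snd z}} =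
      {z. \<bar>(fst z - p) \<bullet> (snd z - p)\<bar> = norm (fst z - p) * norm (snd z - p)}"
    (is "?A = ?B")
  proof (rule Collect_cong)
    fix z :: "'a \<times> 'a"
    have "collinear {p, fst z, snd z} \<longleftrightarrow> collinear {fst z, p, snd z}"
      by (simp add: insert_commute)
    also have "\<dots> \<longleftrightarrow> collinear {0, fst z - p, snd z - p}"
      by (rule collinear_3) (simp add: NO_MATCH_def)
    also have "\<dots> \<longleftrightarrow> \<bar>(fst z - p) \<bullet> (snd z - p)\<bar> = norm (fst z - p) * norm (snd z - p)"
      by (rule norm_cauchy_schwarz_equal[symmetric])
    finally show "collinear {p, fst z, snd z} \<longleftrightarrow>
      \<bar>(fst z - p) \<bullet> (snd z - p)\<bar> = norm (fst z - p) * norm (snd z - p)" .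
  qed
  show ?thesis unfolding eq by (intro closed_Collect_eq continuous_intros)
qed

lemma max_chord_length_attained:
  fixes K :: "'a::euclidean_space set"
  assumes "convex_body K"
  shows "\<exists>a b. chord_through K p a b \<and> max_chord_length K p = dist a b"
    and "chord_through K p a b \<Longrightarrow> dist a b \<le> max_chord_length K p"
proof -
  have K: "compact K" "convex K" "interior K \<noteq> {}" using assms by (auto simp: convex_body_def)
  define C where "C = (K \<times> K) \<inter> {z. collinear {p, fst z, snd z}}"
  obtain u e where u: "e > 0" "cball u e \<subseteq> K"
    using K(3) by (metis all_not_in_conv mem_interior_cball)
  define v where "v = (if u = p then u + e *\<^sub>R (SOME i. i \<in> Basis) else u)"
  have iB: "(SOME i. i \<in> Basis) \<in> (Basis :: 'a set)" by (rule someI_ex) (use nonempty_Basis in blast)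
  have v: "v \<in> K" "v \<noteq> p"
  proof -
    have "dist u (u + e *\<^sub>R (SOME i. i \<in> Basis)) = e"
      using u(1) norm_Basis[OF iB] by (simp add: dist_norm)
    then have "v \<in> cball u e" using u(1) by (auto simp: v_def)
    then show "v \<in> K" using u(2) by blast
    show "v \<noteq> p" using u(1) nonzero_Basis[OF iB] by (simp add: v_def)
  qed
  have "(v, v) \<in> C" using v by (simp add: C_def)
  have "compact C"
    unfolding C_def by (intro compact_Int_closed compact_Times K collinear3_closed)
  obtain z where z: "z \<in> C" and zmax: "\<And>w. w \<in> C \<Longrightarrow> dist (fst w) (snd w) \<le> dist (fst z) (snd z)"
  proof -
    have "continuous_on C (\<lambda>w. dist (fst w) (snd w))" by (intro continuous_intros)
    with \<open>compact C\<close> \<open>(v, v) \<in> C\<close> show ?thesis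
      using continuous_attains_sup[of C "\<lambda>w. dist (fst w) (snd w)"] that by blast
  qed
  have ub: "dist a b \<le> dist (fst z) (snd z)" if "chord_through K p a b" for a b
    using zmax[of "(a, b)"] chord_through_collinear[OF that] by (simp add: C_def)
  have ex: "\<exists>a b. chord_through K p a b \<and> dist a b = dist (fst z) (snd z)"
  proof -
    have "\<exists>L. is_line L \<and> {p, fst z, snd z} \<subseteq> L \<and> L \<inter> K \<noteq> {}"
    proof (cases "fst z = snd z")
      case True
      define q where "q = (if fst z = p then v else fst z)"
      have q: "q \<noteq> p" "q \<in> K" using v z by (auto simp: q_def C_def)
      have "is_line (affine hull {p, q})" using q by (simp add: is_line_def aff_dim_2)
      moreover have "p \<in> affine hull {p, q}" "q \<in> affine hull {p, q}" by (simp_all add: hull_inc)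
      moreover have "fst z = p \<or> fst z = q" by (simp add: q_def)
      ultimately show ?thesis using True q(2) by (intro exI[of _ "affine hull {p, q}"]) auto
    next
      case False
      have "p \<in> affine hull {fst z, snd z}"
      proof -
        have "{fst z, snd z, p} = {p, fst z, snd z}" by blast
        then show ?thesis
          using z False collinear_3_affine_hull[of "fst z" "snd z" p] by (simp add: C_def)
      qed
      moreover have "is_line (affine hull {fst z, snd z})" using False by (simp add: is_line_def aff_dim_2)
      moreover have "fst z \<in> affine hull {fst z, snd z}" "snd z \<in> affine hull {fst z, snd z}"
        by (simp_all add: hull_inc)
      moreover have "fst z \<in> K" using z by (auto simp: C_def)
      ultimately show ?thesis by (intro exI[of _ "affine hull {fst z, snd z}"]) blast
    qed
    then obtain L where L: "is_line L" "{p, fst z, snd z} \<subseteq> L" "L \<inter> K \<noteq> {}" by blast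
    have "p \<in> L" using L(2) by simp
    then obtain a b where ab: "chord_through K p a b" "L \<inter> K = closed_segment a b"
      using chord_through_exists[OF K(1,2) L(1) _ L(3)] by blast
    have "fst z \<in> closed_segment a b" "snd z \<in> closed_segment a b"
      using L(2) z unfolding ab(2)[symmetric] C_def by auto
    then have "dist (fst z) (snd z) \<le> dist a b"
      using dist_decreases_closed_segment[of "fst z" a b "snd z"]
        dist_decreases_closed_segment[of "snd z" a b a]
        dist_decreases_closed_segment[of "snd z" a b b]
      by (auto simp: dist_commute)
    with ub[OF ab(1)] have "dist a b = dist (fst z) (snd z)" by linarith
    with ab(1) show ?thesis by blast
  qed
  have "max_chord_length K p = dist (fst z) (snd z)"
    unfolding max_chord_length_def
  proof (intro cSup_eq_maximum)
    obtain a b where "chord_through K p a b" "dist a b = dist (fst z) (snd z)"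
      using ex by blast
    then show "dist (fst z) (snd z) \<in> {dist a b |a b. chord_through K p a b}"
      by (intro CollectI exI[of _ a] exI[of _ b]) simp
  next
    fix x assume "x \<in> {dist a b |a b. chord_through K p a b}"
    then show "x \<le> dist (fst z) (snd z)" using ub by blast
  qed
  then show "\<exists>a b. chord_through K p a b \<and> max_chord_length K p = dist a b"
    using ex by metis
  show "dist a b \<le> max_chord_length K p" if "chord_through K p a b"
    using ub[OF that] \<open>max_chord_length K p = dist (fst z) (snd z)\<close> by simp
qed

end

theory Submission
  imports Defs
begin

text \<open>For \<open>x\<close> outside \<open>K\<close>, a maximal chord through \<open>x\<close> lies on one side of \<open>x\<close>, so its far
  endpoint is at distance at least \<open>e\<^sub>K(x)\<close> from \<open>x\<close>. Letting \<open>x\<close> tend to \<open>p\<close> from outside, continuity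
  forces the point of \<open>K\<close> farthest from \<open>p\<close> to lie at distance \<open>e\<^sub>K(p)\<close>.
  Conversely, \<open>e\<^sub>K\<close> is always upper semicontinuous by compactness. If \<open>e\<^sub>K(p) = |pq|\<close>, replace \<open>q\<close> by
  a nearby interior point \<open>w\<close>: for \<open>x\<close> near \<open>p\<close> the segment from \<open>x\<close> to \<open>w\<close> has all but a
  small initial part in \<open>K\<close>, which gives lower semicontinuity at \<open>p\<close>. Since \<open>q\<close> is then a point
  of \<open>K\<close> farthest from \<open>p\<close>, it is extreme by strict convexity of the norm.\<close>

text \<open>For \<open>a \<noteq> b\<close> the line through them contains \<open>x\<close>, and the
  chord it cuts from \<open>K\<close> contains both. Lower bounds for
  \<open>max_chord_length K x\<close> thus need only two collinear points of \<open>K\<close>, not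
  the endpoints of a chord.\<close>

lemma dist_le_max_chord_length:
  assumes K: "convex_body K" and ab: "a \<in> K" "b \<in> K" and col: "collinear {x, a, b}"
  shows "dist a b \<le> max_chord_length K x"
proof (cases "a = b")
  case True
  then show ?thesis using max_chord_length_attained(1)[OF K, of x] by auto
next
  case False
  let ?L = "affine hull {a, b}"
  have L: "is_line ?L" using False by (simp add: is_line_def aff_dim_2)
  have "collinear {a, b, x}" using col by (simp add: insert_commute)
  then have x: "x \<in> ?L" using False collinear_3_affine_hull by blast
  have abL: "a \<in> ?L" "b \<in> ?L" by (simp_all add: hull_inc)
  obtain c d where cd: "chord_through K x c d" "?L \<inter> K = closed_segment c d"
    using chord_through_exists[OF _ _ L x] K ab abL unfolding convex_body_def by blast
  have "a \<in> closed_segment c d" "b \<in> closed_segment c d"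
    using ab abL unfolding cd(2)[symmetric] by auto
  then have "dist a b \<le> dist c d"
    using dist_decreases_closed_segment[of a c d b] dist_decreases_closed_segment[of b c d c]
      dist_decreases_closed_segment[of b c d d]
    by (auto simp: dist_commute)
  also have "\<dots> \<le> max_chord_length K x"
    by (rule max_chord_length_attained(2)[OF K cd(1)])
  finally show ?thesis .
qed

lemma dist_point_le_max_chord_length:
  assumes "convex_body K" "p \<in> K" "q \<in> K"
  shows "dist p q \<le> max_chord_length K p"
  using dist_le_max_chord_length[OF assms] by simp

lemma far_endpoint_outside:
  assumes K: "convex_body K" and x: "x \<notin> K"
  shows "\<exists>b\<in>K. max_chord_length K x \<le> dist x b"
proof -
  obtain a b where ab: "chord_through K x a b" "max_chord_length K x = dist a b"
    using max_chord_length_attained(1)[OF K] by blast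
  note c = chord_through_collinear[OF ab(1)]
  \<comment> \<open>By convexity \<open>x\<close> cannot lie between the endpoints, so one endpoint
    lies between \<open>x\<close> and the other.\<close>
  have "x \<notin> closed_segment a b"
    using x c K by (meson closed_segment_subset convex_body_def subsetD)
  then have "between (b, x) a \<or> between (x, a) b"
    using c(1) by (auto simp: collinear_between_cases between_mem_segment)
  then have "dist a b \<le> dist x b \<or> dist a b \<le> dist x a"
    by (auto simp: between dist_commute)
  then show ?thesis using ab(2) c by auto
qed

lemma farthest_point_extreme:
  assumes K: "convex_body K" and p: "p \<in> K" and q: "q \<in> K" "dist p q = max_chord_length K p"
  shows "q extreme_point_of K"
  unfolding extreme_point_of_def
proof (intro conjI ballI notI q(1))
  fix a b assume ab: "a \<in> K" "b \<in> K" "q \<in> open_segment a b"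
  have "dist p q < dist p a \<or> dist p q < dist p b"
    by (rule dist_decreases_open_segment[OF ab(3), rule_format])
  then show False
    using dist_point_le_max_chord_length[OF K p ab(1)]
      dist_point_le_max_chord_length[OF K p ab(2)] q(2) by linarith
qed

lemma continuous_imp_farthest_point:
  assumes K: "convex_body K" and p: "p \<in> frontier K"
    and cont: "isCont (max_chord_length K) p"
  shows "\<exists>q\<in>K. dist p q = max_chord_length K p"
proof -
  have comp: "compact K" using K by (simp add: convex_body_def)
  then have pK: "p \<in> K" using p by (meson compact_imp_closed frontier_subset_closed subsetD)
  obtain q where q: "q \<in> K" "\<And>y. y \<in> K \<Longrightarrow> dist p y \<le> dist p q"
    using distance_attains_sup[OF comp] pK by blast
  \<comment> \<open>Since \<open>p\<close> is a limit point of the complement, inequalities valid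
    outside \<open>K\<close> survive in the limit at \<open>p\<close>.\<close>
  have "p \<in> closure (- K)" using p by (simp add: frontier_closures)
  then have "p islimpt (- K)" using pK by (simp add: closure_def)
  then have nontriv: "at p within (- K) \<noteq> bot" by (simp add: trivial_limit_within)
  have lhs: "(max_chord_length K \<longlongrightarrow> max_chord_length K p) (at p within (- K))"
    using cont by (auto simp: isCont_def intro: tendsto_within_subset)
  have rhs: "((\<lambda>x. dist x p + dist p q) \<longlongrightarrow> dist p p + dist p q) (at p within (- K))"
    by (intro tendsto_intros)
  have "max_chord_length K x \<le> dist x p + dist p q" if x: "x \<in> - K" for x
  proof -
    obtain b where b: "b \<in> K" "max_chord_length K x \<le> dist x b"
      using far_endpoint_outside[OF K] x by blast
    have "dist x b \<le> dist x p + dist p b" by (rule dist_triangle)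
    then show ?thesis using b q(2)[OF b(1)] by linarith
  qed
  then have "max_chord_length K p \<le> dist p p + dist p q"
    by (intro tendsto_le[OF nontriv rhs lhs]) (simp add: eventually_at_filter)
  then show ?thesis
    using q(1) dist_point_le_max_chord_length[OF K pK q(1)] by force
qed

lemma collinear_translated_iff: "collinear {0, a - x, b - x} \<longleftrightarrow> collinear {x, a, b :: 'a::euclidean_space}"
proof -
  have "collinear {a, x, b} \<longleftrightarrow> collinear {0, a - x, b - x}"
    by (rule collinear_3) (simp add: NO_MATCH_def)
  moreover have "{a, x, b} = {x, a, b}" by blast
  ultimately show ?thesis by simp
qed

text \<open>Otherwise chords of length at least \<open>c\<close> pass through points tending to
  \<open>p\<close>. Along a subsequence their endpoints converge to points of \<open>K\<close> that
  are collinear with \<open>p\<close> and at least \<open>c\<close> apart. These limits need not be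
  endpoints of a chord, but \<open>dist_le_max_chord_length\<close> still applies.\<close>

lemma max_chord_length_upper_semicontinuous:
  assumes K: "convex_body K" and c: "max_chord_length K p < c"
  shows "\<forall>\<^sub>F x in at p. max_chord_length K x < c"
proof (rule ccontr)
  assume "\<not> ?thesis"
  then have "\<exists>\<^sub>F x in at p. c \<le> max_chord_length K x"
    by (simp add: frequently_def not_le)
  then have "\<exists>x. dist x p < inverse (real (Suc n)) \<and> c \<le> max_chord_length K x" for n
    unfolding frequently_at by (metis inverse_positive_iff_positive of_nat_0_less_iff zero_less_Suc)
  then obtain x where x: "\<And>n. dist (x n) p < inverse (real (Suc n))"
      "\<And>n. c \<le> max_chord_length K (x n)" by metis
  have "(\<lambda>n. dist (x n) p) \<longlonglongrightarrow> 0"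
  proof (rule Lim_null_comparison[OF _ LIMSEQ_inverse_real_of_nat])
    show "\<forall>\<^sub>F n in sequentially. norm (dist (x n) p) \<le> inverse (real (Suc n))"
      using less_imp_le[OF x(1)] by (intro always_eventually allI) (simp del: of_nat_Suc)
  qed
  then have xlim: "x \<longlonglongrightarrow> p" by (rule tendsto_dist_iff[THEN iffD2])
  have "\<exists>a b. chord_through K (x n) a b \<and> c \<le> dist a b" for n
    using max_chord_length_attained(1)[OF K, of "x n"] x(2)[of n] by metis
  then obtain a b where ab: "\<And>n. chord_through K (x n) (a n) (b n)" "\<And>n. c \<le> dist (a n) (b n)"
    by metis
  have "compact (K \<times> K)" using K by (simp add: convex_body_def compact_Times)
  moreover have "\<forall>n. (a n, b n) \<in> K \<times> K" using chord_through_collinear[OF ab(1)] by blast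
  ultimately obtain l r where l: "l \<in> K \<times> K" and r: "strict_mono r"
    and lim: "((\<lambda>n. (a n, b n)) \<circ> r) \<longlonglongrightarrow> l"
    unfolding compact_def by meson
  obtain \<alpha> \<beta> where l_eq: "l = (\<alpha>, \<beta>)" by fastforce
  have xr: "(\<lambda>n. x (r n)) \<longlonglongrightarrow> p"
    using LIMSEQ_subseq_LIMSEQ[OF xlim r] by (simp add: o_def)
  have ar: "(\<lambda>n. a (r n)) \<longlonglongrightarrow> \<alpha>" and br: "(\<lambda>n. b (r n)) \<longlonglongrightarrow> \<beta>"
    using tendsto_fst[OF lim] tendsto_snd[OF lim] by (simp_all add: l_eq o_def)
  \<comment> \<open>Translating by \<open>x (r n)\<close> turns collinearity into a closed condition with a fixed base point.\<close>
  have "(a (r n) - x (r n), b (r n) - x (r n)) \<in> {z. collinear {0, fst z, snd z}}" for n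
    using chord_through_collinear(1)[OF ab(1), of "r n"]
    by (simp add: collinear_translated_iff)
  moreover have "(\<lambda>n. (a (r n) - x (r n), b (r n) - x (r n))) \<longlonglongrightarrow> (\<alpha> - p, \<beta> - p)"
    by (intro tendsto_intros ar br xr)
  ultimately have "(\<alpha> - p, \<beta> - p) \<in> {z. collinear {0, fst z, snd z}}"
    by (rule closed_sequentially[OF collinear3_closed])
  then have "collinear {p, \<alpha>, \<beta>}"
    by (simp add: collinear_translated_iff)
  then have "dist \<alpha> \<beta> \<le> max_chord_length K p"
    using dist_le_max_chord_length[OF K] l l_eq by auto
  moreover have "c \<le> dist \<alpha> \<beta>"
    by (rule LIMSEQ_le_const[OF tendsto_dist[OF ar br]]) (use ab(2) in auto)
  ultimately show False using c by linarith
qed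

lemma max_chord_length_lower_semicontinuous:
  assumes K: "convex_body K" and p: "p \<in> K" and q: "q \<in> K" and c: "c < dist p q"
  shows "\<forall>\<^sub>F x in at p. c < max_chord_length K x"
proof -
  have cv: "convex K" and int: "interior K \<noteq> {}" using K by (auto simp: convex_body_def)
  have "q \<in> closure (interior K)"
    using q closure_subset convex_closure_interior[OF cv int] by blast
  \<comment> \<open>The segment from a nearby \<open>x\<close> to \<open>q\<close> itself may miss
    the interior of \<open>K\<close>. An interior \<open>w\<close> this close to \<open>q\<close>
    still satisfies \<open>c < dist p w\<close>.\<close>
  then obtain w where w: "w \<in> interior K" "dist w q < dist p q - c"
    using c unfolding closure_approachable by (metis diff_gt_0_iff_gt)
  have cw: "c < dist p w" using w(2) dist_triangle[of p q w] by (simp add: dist_commute)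
  \<comment> \<open>\<open>s\<close> is the fraction of the segment to be cut off at the end
    \<open>x\<close>; it must be positive, yet small enough that the rest is longer than
    \<open>c\<close>.\<close>
  have "((\<lambda>s. (1 - s) * dist p w) \<longlongrightarrow> (1 - 0) * dist p w) (at_right 0)"
    by (intro tendsto_intros)
  then have "\<forall>\<^sub>F s in at_right 0. c < (1 - s) * dist p w"
    using cw by (auto dest: order_tendstoD(1))
  moreover have "\<forall>\<^sub>F s in at_right (0::real). 0 < s \<and> s < 1"
    using eventually_at_right_real[of 0 "1::real"] by simp
  ultimately have "\<forall>\<^sub>F s in at_right 0. c < (1 - s) * dist p w \<and> 0 < s \<and> s < 1"
    by eventually_elim simp
  then obtain s where s: "c < (1 - s) * dist p w" "0 < s" "s < 1"
    using eventually_happens trivial_limit_at_right_real by blast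
  define y where "y = (\<lambda>x. x + s *\<^sub>R (w - x))"
  have "y p = p - s *\<^sub>R (p - w)" by (simp add: y_def algebra_simps)
  \<comment> \<open>Moving from \<open>p\<close> towards the interior point \<open>w\<close> enters
    the interior at once, and by continuity \<open>y x\<close> stays there for \<open>x\<close> near
    \<open>p\<close>.\<close>
  then have yp: "y p \<in> interior K"
    using mem_interior_convex_shrink[OF cv w(1) p s(2)] s(3) by simp
  have "(y \<longlongrightarrow> y p) (at p)" unfolding y_def by (intro tendsto_intros)
  then have ev1: "\<forall>\<^sub>F x in at p. y x \<in> interior K"
    using yp by (auto dest: topological_tendstoD)
  have "((\<lambda>x. (1 - s) * dist x w) \<longlongrightarrow> (1 - s) * dist p w) (at p)"
    by (intro tendsto_intros)
  then have ev2: "\<forall>\<^sub>F x in at p. c < (1 - s) * dist x w"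
    using s(1) by (auto dest: order_tendstoD(1))
  show ?thesis using ev1 ev2
  proof eventually_elim
    case (elim x)
    have "y x \<in> closed_segment x w"
      using s by (auto simp: y_def closed_segment_def algebra_simps intro!: exI[of _ s])
    then have "collinear {x, y x, w}"
      by (auto simp: collinear_between_cases between_mem_segment closed_segment_commute)
    then have "dist (y x) w \<le> max_chord_length K x"
      using dist_le_max_chord_length[OF K] elim(1) w(1) interior_subset by blast
    moreover have "y x - w = (1 - s) *\<^sub>R (x - w)" by (simp add: y_def algebra_simps)
    then have "dist (y x) w = (1 - s) * dist x w" using s by (simp add: dist_norm)
    ultimately show ?case using elim(2) by simp
  qed
qed

text \<open>With \<open>q\<close> ranging over all of \<open>K\<close>, this is the common form to
  which both the chord criterion and the frontier criterion are reduced.\<close>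

lemma isCont_max_chord_length_iff:
  assumes K: "convex_body K" and p: "p \<in> frontier K"
  shows "isCont (max_chord_length K) p \<longleftrightarrow> (\<exists>q\<in>K. dist p q = max_chord_length K p)"
proof
  assume "\<exists>q\<in>K. dist p q = max_chord_length K p"
  then obtain q where q: "q \<in> K" "dist p q = max_chord_length K p" by blast
  have "p \<in> K"
    using K p unfolding convex_body_def by (meson compact_imp_closed frontier_subset_closed subsetD)
  then show "isCont (max_chord_length K) p"
    unfolding isCont_def
    using max_chord_length_lower_semicontinuous[OF K _ q(1)]
      max_chord_length_upper_semicontinuous[OF K] q(2)
    by (intro order_tendstoI) auto
qed (rule continuous_imp_farthest_point[OF K p])

lemma chord_through_farthest_point:
  assumes K: "convex_body K" and p: "p \<in> K" and q: "q \<in> K" "dist p q = max_chord_length K p"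
  shows "chord_through K p p q"
proof -
  \<comment> \<open>A second point of \<open>K\<close> makes \<open>max_chord_length K p\<close>
    positive, so that \<open>p\<close> and \<open>q\<close> determine a line.\<close>
  obtain z where z: "z \<in> K" "z \<noteq> p"
  proof -
    have "\<not> K \<subseteq> {p}"
      using K interior_mono[of K "{p}"] unfolding convex_body_def by auto
    then show ?thesis using that by blast
  qed
  have "0 < dist p z" using z(2) by simp
  then have ne: "p \<noteq> q" using dist_point_le_max_chord_length[OF K p z(1)] q(2) by auto
  let ?L = "affine hull {p, q}"
  have L: "is_line ?L" using ne by (simp add: is_line_def aff_dim_2)
  have pL: "p \<in> ?L" "q \<in> ?L" by (simp_all add: hull_inc)
  have "?L \<inter> K = closed_segment p q"
  proof
    show "closed_segment p q \<subseteq> ?L \<inter> K"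
      using K p q(1) pL unfolding convex_body_def
      by (intro closed_segment_subset convex_Int) (auto simp: affine_imp_convex)
    show "?L \<inter> K \<subseteq> closed_segment p q"
    proof
      fix y assume "y \<in> ?L \<inter> K"
      then have y: "y \<in> ?L" "y \<in> K" by auto
      have col: "collinear {p, q, y}" using y(1) ne collinear_3_affine_hull by blast
      have "dist p y \<le> dist p q" using dist_point_le_max_chord_length[OF K p y(2)] q(2) by simp
      moreover have "dist q y \<le> dist p q"
        using dist_le_max_chord_length[OF K q(1) y(2) col] q(2) by simp
      moreover have "between (q, y) p \<or> between (y, p) q \<or> between (p, q) y"
        using col by (simp add: collinear_between_cases)
      \<comment> \<open>If \<open>y\<close> lay beyond \<open>p\<close>, then
        \<open>dist q y\<close> would be \<open>dist p q + dist p y\<close>, so maximality forces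
        \<open>y = p\<close>; beyond \<open>q\<close> the argument is symmetric.\<close>
      ultimately have "between (p, q) y \<or> dist p y \<le> 0 \<or> dist q y \<le> 0"
        unfolding between by (smt (verit) dist_commute)
      then have "between (p, q) y" by auto
      then show "y \<in> closed_segment p q" by (simp add: between_mem_segment)
    qed
  qed
  then show ?thesis unfolding chord_through_def using L pL by blast
qed

theorem proposition7:
  fixes K :: "(real ^ 'n) set" and p :: "real ^ 'n"
  assumes "CARD('n) \<ge> 2"
    and "convex_body K"
    and "p \<in> frontier K"
  shows "(isCont (max_chord_length K) p \<longleftrightarrow>
            (\<exists>a b. chord_through K p a b \<and> dist a b = max_chord_length K p \<and> (p = a \<or> p = b)))
       \<and> (isCont (max_chord_length K) p \<longleftrightarrow>
            (\<exists>p' \<in> frontier K. max_chord_length K p = dist p p'))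
       \<and> (isCont (max_chord_length K) p \<longrightarrow>
            (\<forall>p' \<in> frontier K. max_chord_length K p = dist p p' \<longrightarrow> p' extreme_point_of K))"
proof -
  note K = assms(2) and iff = isCont_max_chord_length_iff[OF assms(2,3)]
  have fr: "frontier K \<subseteq> K"
    using K by (simp add: convex_body_def compact_imp_closed frontier_subset_closed)
  then have p: "p \<in> K" using assms(3) by blast
  have ext: "q extreme_point_of K" if "q \<in> K" "dist p q = max_chord_length K p" for q
    using farthest_point_extreme[OF K p that] .
  \<comment> \<open>Extremality already places \<open>q\<close> on the frontier, as an extreme point
    is never interior.\<close>
  have fro: "q \<in> frontier K" if "q \<in> K" "dist p q = max_chord_length K p" for q
    using extreme_point_not_in_interior[OF ext[OF that]] that(1) closure_subset
    by (auto simp: frontier_def)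
  have "(\<exists>q\<in>K. dist p q = max_chord_length K p) \<longleftrightarrow>
      (\<exists>a b. chord_through K p a b \<and> dist a b = max_chord_length K p \<and> (p = a \<or> p = b))"
    using chord_through_farthest_point[OF K p] chord_through_collinear(2,3)
    by (metis dist_commute)
  moreover have "(\<exists>q\<in>K. dist p q = max_chord_length K p) \<longleftrightarrow>
      (\<exists>p'\<in>frontier K. max_chord_length K p = dist p p')"
    using fro fr by (metis subsetD)
  moreover have "\<forall>p'\<in>frontier K. max_chord_length K p = dist p p' \<longrightarrow> p' extreme_point_of K"
    using ext fr by (metis subsetD)
  ultimately show ?thesis using iff by simp
qed

end
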